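(* Let $Z_n^\star$, $n\ge3$, be the symmetrical version of the Meyer-König and Zeller operators (defined in the context). Then $Z_n^\star\in\Lambda$ for every $n\ge3$ and, with $L_n=Z_n^\star$ and $M_n^k,\alpha_n,\nu_n,\eta_n$ as defined in the context, the sequence $(Z_n^\star)_{n\ge3}$ satisfies, as $n\to\infty$: (1) $M_n^4(x)=\mathrm{o}(M_n^2(x))$ uniformly with regard to $x\in[0,1]$; (2) $\eta_n=\mathrm{o}(1)$; (3) $Z_n^\star\big(\psi\,|\alpha_n-\alpha_n(x)e_0|\big)(x)=\mathrm{o}\big(\nu_n^2\,\psi(x)\big)$ uniformly for $x\in[0,1]$. (Here "$A_n(x)=\mathrm{o}(B_n(x))$ uniformly" means that there is a sequence of positive numbers $c_n\to0$ with $A_n(x)\le c_nB_n(x)$ for all $x\in[0,1]$ and all $n\ge3$.)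
   Context: $C[0,1]$ is the space of continuous functions $[0,1]\to\mathbb{R}$; $e_j(t)=t^j$ on $[0,1]$; $\psi(x)=x(1-x)$. For a function $f$ on $[0,1]$, $\|f\|_\psi=\sup_{x\in(0,1)}|f(x)|/\psi(x)$. $B_1(f)(x)=(1-x)f(0)+xf(1)$. $\Lambda$ is the class of all positive linear operators $L:C[0,1]\to C[0,1]$ such that (a) $L$ preserves linear functions; (b) $\|L(\psi)\|_\psi<1$; (c) $L\neq B_1$. For $L\in\Lambda$, $b_L(x)=L(\psi)(x)/\psi(x)$ for $x\in(0,1)$ and $b_L(x)=\|L(\psi)\|_\psi$ for $x\in\{0,1\}$. The Meyer-König and Zeller operators are, for $f\in C[0,1]$, $Z_n(f)(x)=\sum_{k=0}^\infty\binom{n+k}{k}(1-x)^{n+1}x^k f\left(\frac{k}{n+k}\right)$ for $x\in[0,1)$ and $Z_n(f)(1)=f(1)$. With $\tau=e_0-e_1$, put $Z_n^1(f)(x)=Z_n(f\circ\tau)(1-x)$ and $Z_n^\star(f)=\frac12\big(Z_n(f)+Z_n^1(f)\big)$, for $f\in C[0,1]$, $x\in[0,1]$. For $L_n=Z_n^\star$: $\alpha_n=1-b_{L_n}$, $\nu_n=\min_{x\in[0,1]}\alpha_n(x)$, $\eta_n=\sup_{x,y\in[0,1]}|\alpha_n(x)-\alpha_n(y)|/\nu_n$, and $M_n^k(x)=L_n((e_1-xe_0)^k)(x)$ (the superscript is an index; $M_n^2=\alpha_n\psi$). *)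

theory Defs
  imports "HOL-Analysis.Analysis"
begin

text \<open>
  An element of \<open>C[0,1]\<close> is represented by any function on the reals that is continuous on
  \<open>{0..1}\<close>; only its values on \<open>{0..1}\<close> are meaningful. An operator on \<open>C[0,1]\<close> acts on
  such representatives and has to respect equality on \<open>{0..1}\<close>.
\<close>

type_synonym oper = "(real \<Rightarrow> real) \<Rightarrow> real \<Rightarrow> real"

definition C01 :: "(real \<Rightarrow> real) set" where
  "C01 = {f. continuous_on {0..1} f}"

definition e :: "nat \<Rightarrow> real \<Rightarrow> real" where
  "e j t = t ^ j"

definition psi :: "real \<Rightarrow> real" where
  "psi x = x * (1 - x)"

text \<open>Extended-real valued, so that an unbounded quotient gives \<open>\<infinity>\<close>.\<close>

definition norm_psi :: "(real \<Rightarrow> real) \<Rightarrow> ereal" where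
  "norm_psi f = (SUP x\<in>{0<..<1}. ereal (\<bar>f x\<bar> / psi x))"

definition positive_linear_operator :: "oper \<Rightarrow> bool" where
  "positive_linear_operator L \<longleftrightarrow>
     (\<forall>f\<in>C01. L f \<in> C01) \<and>
     (\<forall>f\<in>C01. \<forall>g\<in>C01. (\<forall>t\<in>{0..1}. f t = g t) \<longrightarrow> (\<forall>x\<in>{0..1}. L f x = L g x)) \<and>
     (\<forall>f\<in>C01. \<forall>g\<in>C01. \<forall>a b. \<forall>x\<in>{0..1}. L (\<lambda>t. a * f t + b * g t) x = a * L f x + b * L g x) \<and>
     (\<forall>f\<in>C01. (\<forall>t\<in>{0..1}. 0 \<le> f t) \<longrightarrow> (\<forall>x\<in>{0..1}. 0 \<le> L f x))"

definition preserves_linear_functions :: "oper \<Rightarrow> bool" where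
  "preserves_linear_functions L \<longleftrightarrow>
     (\<forall>a b. \<forall>x\<in>{0..1}. L (\<lambda>t. a * e 0 t + b * e 1 t) x = a * e 0 x + b * e 1 x)"

definition B1 :: oper where
  "B1 f x = (1 - x) * f 0 + x * f 1"

definition Lambda :: "oper set" where
  "Lambda = {L. positive_linear_operator L \<and> preserves_linear_functions L \<and>
                norm_psi (L psi) < 1 \<and> (\<exists>f\<in>C01. \<exists>x\<in>{0..1}. L f x \<noteq> B1 f x)}"

text \<open>For \<open>L \<in> Lambda\<close> the norm below is finite, so the conversion to a real loses nothing.\<close>

definition b :: "oper \<Rightarrow> real \<Rightarrow> real" where
  "b L x = (if x \<in> {0<..<1} then L psi x / psi x else real_of_ereal (norm_psi (L psi)))"

definition alpha :: "oper \<Rightarrow> real \<Rightarrow> real" where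
  "alpha L x = 1 - b L x"

text \<open>
  The minimum over \<open>[0,1]\<close>. For \<open>L \<in> Lambda\<close> it exists (it is attained at the end points)
  and is positive.
\<close>

definition nu :: "oper \<Rightarrow> real" where
  "nu L = (LEAST v. v \<in> alpha L ` {0..1})"

definition eta :: "oper \<Rightarrow> ereal" where
  "eta L = (SUP (x, y)\<in>{0..1} \<times> {0..1}. ereal (\<bar>alpha L x - alpha L y\<bar> / nu L))"

definition M :: "oper \<Rightarrow> nat \<Rightarrow> real \<Rightarrow> real" where
  "M L k x = L (\<lambda>t. (e 1 t - x * e 0 t) ^ k) x"

definition MKZ :: "nat \<Rightarrow> oper" where
  "MKZ n f x =
     (if x = 1 then f 1
      else (\<Sum>k. real ((n + k) choose k) * (1 - x) ^ (n + 1) * x ^ k * f (real k / real (n + k))))"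

definition tau :: "real \<Rightarrow> real" where
  "tau t = e 0 t - e 1 t"

definition MKZ_reflected :: "nat \<Rightarrow> oper" where
  "MKZ_reflected n f x = MKZ n (f \<circ> tau) (1 - x)"

definition MKZ_star :: "nat \<Rightarrow> oper" where
  "MKZ_star n f x = (1/2) * (MKZ n f x + MKZ_reflected n f x)"

definition uniform_little_o :: "(nat \<Rightarrow> real \<Rightarrow> real) \<Rightarrow> (nat \<Rightarrow> real \<Rightarrow> real) \<Rightarrow> bool" where
  "uniform_little_o A B \<longleftrightarrow>
     (\<exists>c :: nat \<Rightarrow> real. (\<forall>n\<ge>3. 0 < c n) \<and> c \<longlonglongrightarrow> 0 \<and>
        (\<forall>n\<ge>3. \<forall>x\<in>{0..1}. A n x \<le> c n * B n x))"

end

theory Submission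
  imports Defs "HOL-Real_Asymp.Real_Asymp"
begin

text \<open>
  For \<open>0 \<le> x < 1\<close> the value \<open>Z\<^sub>n(f)(x)\<close> is the mean of \<open>f(k/(n+k))\<close> under a negative binomial
  distribution. Two index shifts drive everything: multiplying by the node \<open>t = k/(n+k)\<close> pulls out a
  factor \<open>x\<close> and moves \<open>k\<close> to \<open>k+1\<close>, and multiplying by \<open>1-t\<close> pulls out \<open>1-x\<close> and lowers \<open>n\<close> by one.
  The first gives \<open>Z\<^sub>n((t-x) g) = x Z\<^sub>n(\<Delta>g)\<close>, so the second moment of \<open>Z\<^sub>n\<close> is \<open>\<psi>(x) A\<^sub>n(x)\<close>, where
  \<open>A\<^sub>n(x)\<close> is a mean of \<open>1/(n+1+k)\<close>, and the fourth moment is at most \<open>7\<psi>(x)/n\<^sup>2\<close>.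

  The key estimate is that \<open>R\<^sub>n(x) = A\<^sub>n(x) - (1-x)/(n+1)\<close> is nonnegative, vanishes at both end points
  and is Lipschitz with constant \<open>2/(n\<^sup>2-1)\<close>. Symmetrization cancels the linear terms:
  \<open>\<alpha>\<^sub>n(x) = 1/(2(n+1)) + (R\<^sub>n(x) + R\<^sub>n(1-x))/2\<close>. Hence \<open>\<nu>\<^sub>n = 1/(2(n+1))\<close>, \<open>\<alpha>\<^sub>n\<close> is Lipschitz with
  constant \<open>O(\<nu>\<^sub>n\<^sup>2)\<close>, and (3) follows from \<open>\<bar>t-x\<bar> \<le> d + (t-x)\<^sup>2/(4d)\<close> with \<open>d = n\<^sup>-\<^sup>1\<^sup>/\<^sup>2\<close>.
\<close>

section \<open>Negative binomial means\<close>

definition mkz_weight :: "nat \<Rightarrow> real \<Rightarrow> nat \<Rightarrow> real" where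
  "mkz_weight n x k = real ((n + k) choose k) * (1 - x) ^ (n + 1) * x ^ k"

text \<open>The argument is an arbitrary sequence, not a function of the node, so that shifts and
  increments in \<open>k\<close> can be averaged too. At \<open>x = 1\<close> every weight vanishes
  and the mean is 0, which is why \<open>MKZ\<close> is treated separately there.\<close>

definition mkz_mean :: "nat \<Rightarrow> (nat \<Rightarrow> real) \<Rightarrow> real \<Rightarrow> real" where
  "mkz_mean n g x = (\<Sum>k. mkz_weight n x k * g k)"

definition mkz_node :: "nat \<Rightarrow> nat \<Rightarrow> real" where
  "mkz_node n k = real k / real (n + k)"

text \<open>Newton's binomial series with exponent \<open>-(n + 1)\<close>: upper negation turns its
  coefficients into \<open>(n + k) choose k\<close> up to a sign, which the powers of
  \<open>- x\<close> absorb.\<close>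

lemma negative_binomial_sums:
  fixes x :: real
  assumes "\<bar>x\<bar> < 1"
  shows "(\<lambda>k. real ((n + k) choose k) * x ^ k) sums (1 / (1 - x) ^ (n + 1))"
proof -
  have "(\<lambda>k. (- (real n + 1) gchoose k) * (- x) ^ k) sums (1 + - x) powr (- (real n + 1))"
    using assms by (intro gen_binomial_real) auto
  moreover have "(- (real n + 1) gchoose k) * (- x) ^ k = real ((n + k) choose k) * x ^ k" for k
  proof -
    have "(- (real n + 1) gchoose k) = (-1) ^ k * (real (n + k) gchoose k)"
      by (subst gbinomial_negated_upper) (simp add: add_ac)
    then show ?thesis
      using power_mult_distrib[of "-1" "- x" k] by (simp add: binomial_gbinomial mult_ac)
  qed
  moreover have "(1 + - x) powr (- (real n + 1)) = 1 / (1 - x) ^ (n + 1)"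
  proof -
    have "(1 - x) powr (real (n + 1)) = (1 - x) ^ (n + 1)"
      using assms by (intro powr_realpow) auto
    then show ?thesis by (simp only: powr_minus_divide of_nat_add of_nat_1 flip: diff_conv_add_uminus)
  qed
  ultimately show ?thesis by simp
qed

lemma mkz_weight_nonneg: "0 \<le> x \<Longrightarrow> x \<le> 1 \<Longrightarrow> 0 \<le> mkz_weight n x k"
  by (simp add: mkz_weight_def)

lemma mkz_weight_sums:
  assumes "0 \<le> x" "x < 1"
  shows "mkz_weight n x sums 1"
  using sums_mult[OF negative_binomial_sums[of x n], of "(1 - x) ^ (n + 1)"] assms
  by (simp add: mkz_weight_def[abs_def] mult_ac)

lemma mkz_summable:
  assumes "0 \<le> x" "x < 1" "\<And>k. \<bar>g k\<bar> \<le> B"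
  shows "summable (\<lambda>k. mkz_weight n x k * g k)"
proof (rule summable_comparison_test')
  show "summable (\<lambda>k. mkz_weight n x k * B)"
    using mkz_weight_sums[OF assms(1,2)] by (intro summable_mult2) (auto simp: sums_iff)
  show "norm (mkz_weight n x k * g k) \<le> mkz_weight n x k * B" for k
    using assms mkz_weight_nonneg[of x n k] by (auto simp: abs_mult intro!: mult_left_mono)
qed

lemma mkz_mean_const:
  "0 \<le> x \<Longrightarrow> x < 1 \<Longrightarrow> mkz_mean n (\<lambda>_. c) x = c"
  using sums_mult2[OF mkz_weight_sums[of x n], of c] by (simp add: mkz_mean_def sums_iff)

lemma mkz_mean_mono:
  assumes "0 \<le> x" "x < 1" "\<And>k. \<bar>g k\<bar> \<le> B" "\<And>k. \<bar>h k\<bar> \<le> C" "\<And>k. g k \<le> h k"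
  shows "mkz_mean n g x \<le> mkz_mean n h x"
  unfolding mkz_mean_def
proof (rule suminf_le)
  show "mkz_weight n x k * g k \<le> mkz_weight n x k * h k" for k
    using assms(1,2,5) mkz_weight_nonneg[of x n k] by (intro mult_left_mono) auto
  show "summable (\<lambda>k. mkz_weight n x k * g k)" by (rule mkz_summable[OF assms(1-3)])
  show "summable (\<lambda>k. mkz_weight n x k * h k)" by (rule mkz_summable[OF assms(1,2,4)])
qed

lemma mkz_mean_linear:
  assumes "0 \<le> x" "x < 1" "\<And>k. \<bar>g k\<bar> \<le> B" "\<And>k. \<bar>h k\<bar> \<le> C"
  shows "mkz_mean n (\<lambda>k. a * g k + c * h k) x = a * mkz_mean n g x + c * mkz_mean n h x"
proof -
  have "(\<lambda>k. a * (mkz_weight n x k * g k) + c * (mkz_weight n x k * h k))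
          sums (a * mkz_mean n g x + c * mkz_mean n h x)"
    unfolding mkz_mean_def
    by (intro sums_add sums_mult summable_sums mkz_summable[of x g B] mkz_summable[of x h C] assms)
  moreover have "(\<lambda>k. a * (mkz_weight n x k * g k) + c * (mkz_weight n x k * h k)) =
    (\<lambda>k. mkz_weight n x k * (a * g k + c * h k))" by (simp add: algebra_simps)
  ultimately show ?thesis unfolding mkz_mean_def by (simp add: sums_iff)
qed

lemma mkz_mean_cmult:
  assumes "0 \<le> x" "x < 1" "\<And>k. \<bar>g k\<bar> \<le> B"
  shows "mkz_mean n (\<lambda>k. a * g k) x = a * mkz_mean n g x"
  using mkz_mean_linear[of x g B g B n a 0, OF assms assms(3)] by simp

lemma mkz_mean_diff:
  assumes "0 \<le> x" "x < 1" "\<And>k. \<bar>g k\<bar> \<le> B" "\<And>k. \<bar>h k\<bar> \<le> C"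
  shows "mkz_mean n (\<lambda>k. g k - h k) x = mkz_mean n g x - mkz_mean n h x"
  using mkz_mean_linear[of x g B h C n 1 "-1", OF assms] by simp

lemma mkz_node_bounds: "0 \<le> mkz_node n k" "mkz_node n k \<le> 1"
  unfolding mkz_node_def by (simp, rule divide_le_eq_1[THEN iffD2], linarith)

text \<open>Isolates the product of a binomial coefficient and a node factor inside a weighted term,
  ready for the absorption identity in both index shifts.\<close>

lemma mult_divide_regroup: "a * p * q * (s / t * g) = (a * s / t) * (p * q * g)" for a :: real
  by (simp add: mult_ac)

text \<open>By the absorption identity, \<open>Suc (n + k) choose Suc k\<close> times the node at
  \<open>Suc k\<close> is \<open>(n + k) choose k\<close>. So the term at \<open>Suc k\<close>
  carries the weight at \<open>k\<close> and a spare factor \<open>x\<close>; the term at 0 vanishes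
  with its node.\<close>

lemma mkz_mean_node_shift:
  assumes "0 \<le> x" "x < 1" "\<And>k. \<bar>g k\<bar> \<le> B" "n \<noteq> 0"
  shows "mkz_mean n (\<lambda>k. mkz_node n k * g k) x = x * mkz_mean n (\<lambda>k. g (Suc k)) x"
proof -
  let ?f = "\<lambda>k. mkz_weight n x k * (mkz_node n k * g k)"
  have B: "\<bar>mkz_node n k * g k\<bar> \<le> B" for k
  proof -
    have "\<bar>mkz_node n k\<bar> * \<bar>g k\<bar> \<le> 1 * B"
      using mkz_node_bounds[of n k] assms(3)[of k] by (intro mult_mono) auto
    then show ?thesis by (simp only: abs_mult mult_1)
  qed
  have Suc: "?f (Suc k) = x * (mkz_weight n x k * g (Suc k))" for k
  proof -
    have "Suc k * (Suc (n + k) choose Suc k) = Suc (n + k) * ((n + k) choose k)"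
      by (rule Suc_times_binomial)
    then have "real (Suc k) * real ((Suc (n + k)) choose Suc k) =
        real (Suc (n + k)) * real ((n + k) choose k)" by (metis of_nat_mult)
    then have "real (Suc (n + k) choose Suc k) * real (Suc k) / real (Suc (n + k)) = real ((n + k) choose k)"
      by (simp add: field_simps del: binomial_Suc_Suc of_nat_Suc)
    moreover have "?f (Suc k) = (real (Suc (n + k) choose Suc k) * real (Suc k) / real (Suc (n + k)))
        * ((1 - x) ^ (n + 1) * x ^ Suc k * g (Suc k))"
      unfolding mkz_weight_def mkz_node_def add_Suc_right by (rule mult_divide_regroup)
    ultimately have "?f (Suc k) = real ((n + k) choose k) * ((1 - x) ^ (n + 1) * x ^ Suc k * g (Suc k))"
      by (simp only:)
    then show ?thesis by (simp add: mkz_weight_def mult_ac)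
  qed
  have "summable ?f" by (rule mkz_summable[OF assms(1,2) B])
  then have "suminf ?f = (\<Sum>k. ?f (Suc k)) + ?f 0"
    using suminf_split_head[of ?f] by linarith
  also have "?f 0 = 0" by (simp add: mkz_node_def)
  finally have "suminf ?f = (\<Sum>k. x * (mkz_weight n x k * g (Suc k)))"
    by (simp only: Suc add_0_right)
  then show ?thesis
    using suminf_mult[OF mkz_summable[of x "\<lambda>k. g (Suc k)" B n, OF assms(1-3)], of x]
    by (simp add: mkz_mean_def)
qed

text \<open>The extra factor is \<open>1 - mkz_node (Suc n) k\<close>. Absorption, used in its
  symmetric form, reduces the binomial coefficient to order \<open>n\<close>, and one power of
  \<open>1 - x\<close> is left over.\<close>

lemma mkz_mean_co_node:
  assumes "0 \<le> x" "x < 1" "\<And>k. \<bar>g k\<bar> \<le> B"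
  shows "mkz_mean (Suc n) (\<lambda>k. real (Suc n) / real (Suc n + k) * g k) x = (1 - x) * mkz_mean n g x"
proof -
  have "mkz_weight (Suc n) x k * (real (Suc n) / real (Suc n + k) * g k)
      = (1 - x) * (mkz_weight n x k * g k)" for k
  proof -
    have "Suc n * (Suc (n + k) choose Suc n) = Suc (n + k) * ((n + k) choose n)"
      by (rule Suc_times_binomial)
    moreover have "Suc (n + k) choose Suc n = (Suc n + k) choose k" "(n + k) choose n = (n + k) choose k"
      using binomial_symmetric[of k "Suc n + k"] binomial_symmetric[of k "n + k"] by simp_all
    ultimately have "real (Suc n) * real ((Suc n + k) choose k) = real (Suc n + k) * real ((n + k) choose k)"
      by (metis of_nat_mult add_Suc)
    then have "real (Suc n + k choose k) * real (Suc n) / real (Suc n + k) = real ((n + k) choose k)"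
      by (simp add: field_simps del: of_nat_Suc)
    moreover have "mkz_weight (Suc n) x k * (real (Suc n) / real (Suc n + k) * g k) =
        (real (Suc n + k choose k) * real (Suc n) / real (Suc n + k)) * ((1 - x) ^ (Suc n + 1) * x ^ k * g k)"
      unfolding mkz_weight_def by (rule mult_divide_regroup)
    ultimately have "mkz_weight (Suc n) x k * (real (Suc n) / real (Suc n + k) * g k) =
        real ((n + k) choose k) * ((1 - x) ^ (Suc n + 1) * x ^ k * g k)"
      by (simp only:)
    then show ?thesis by (simp add: mkz_weight_def mult_ac)
  qed
  then show ?thesis
    using suminf_mult[OF mkz_summable[OF assms, of n], of "1 - x"] by (simp add: mkz_mean_def)
qed

lemma MKZ_eq_mean: "x \<noteq> 1 \<Longrightarrow> MKZ n f x = mkz_mean n (\<lambda>k. f (mkz_node n k)) x"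
  by (simp add: MKZ_def mkz_mean_def mkz_weight_def mkz_node_def)

lemma C01_bounded:
  assumes "f \<in> C01"
  obtains B where "\<And>t. t \<in> {0..1} \<Longrightarrow> \<bar>f t\<bar> \<le> B"
proof -
  have "bounded (f ` {0..1})"
    using assms by (intro compact_imp_bounded compact_continuous_image) (auto simp: C01_def)
  then have "\<exists>B. \<forall>t\<in>{0..1}. \<bar>f t\<bar> \<le> B"
    by (auto simp: bounded_iff)
  then show ?thesis using that by blast
qed

lemma C01_bounded_node:
  assumes "f \<in> C01"
  obtains B where "\<And>n k. \<bar>f (mkz_node n k)\<bar> \<le> B"
proof (rule C01_bounded[OF assms])
  fix B assume "\<And>t. t \<in> {0..1} \<Longrightarrow> \<bar>f t\<bar> \<le> B"
  then show ?thesis using mkz_node_bounds by (intro that[of B]) auto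
qed

section \<open>Power series form and differentiation of the means\<close>

lemma mkz_powser_summable:
  fixes x :: real
  assumes "\<bar>x\<bar> < 1" "\<And>k. \<bar>g k\<bar> \<le> B"
  shows "summable (\<lambda>k. (real ((n + k) choose k) * g k) * x ^ k)"
proof (rule summable_comparison_test')
  show "summable (\<lambda>k. real ((n + k) choose k) * \<bar>x\<bar> ^ k * B)"
    using negative_binomial_sums[of "\<bar>x\<bar>" n] assms(1) by (intro summable_mult2) (auto simp: sums_iff)
  show "norm ((real ((n + k) choose k) * g k) * x ^ k) \<le> real ((n + k) choose k) * \<bar>x\<bar> ^ k * B" for k
  proof -
    have "norm ((real ((n + k) choose k) * g k) * x ^ k) = real ((n + k) choose k) * \<bar>x\<bar> ^ k * \<bar>g k\<bar>"
      by (simp add: abs_mult power_abs)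
    also have "\<dots> \<le> real ((n + k) choose k) * \<bar>x\<bar> ^ k * B"
      by (intro mult_left_mono assms(2)) simp
    finally show ?thesis .
  qed
qed

lemma mkz_mean_powser:
  fixes x :: real
  assumes "\<bar>x\<bar> < 1" "\<And>k. \<bar>g k\<bar> \<le> B"
  shows "mkz_mean n g x = (1 - x) ^ (n + 1) * (\<Sum>k. (real ((n + k) choose k) * g k) * x ^ k)"
proof -
  have "mkz_weight n x k * g k = (1 - x) ^ (n + 1) * ((real ((n + k) choose k) * g k) * x ^ k)" for k
    by (simp add: mkz_weight_def mult_ac)
  then show ?thesis
    unfolding mkz_mean_def by (simp only: suminf_mult[OF mkz_powser_summable[OF assms]])
qed

text \<open>The mean is \<open>(1 - x)^(n + 1) * P x\<close> with a power series \<open>P\<close>.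
  The product rule yields a series with the same weights, so the derivative is again a mean, now of
  scaled increments of \<open>g\<close>.\<close>

lemma mkz_mean_has_derivative:
  fixes x :: real
  assumes "0 \<le> x" "x < 1" "\<And>k. \<bar>g k\<bar> \<le> B"
  shows "(mkz_mean n g has_real_derivative
    mkz_mean n (\<lambda>k. real (n + 1 + k) * (g (Suc k) - g k)) x / (1 - x)) (at x)"
proof -
  define c where "c k = real ((n + k) choose k) * g k" for k
  define P where "P y = (\<Sum>k. c k * y ^ k)" for y :: real
  define P' where "P' = (\<Sum>k. diffs c k * x ^ k)"
  have c: "summable (\<lambda>k. c k * y ^ k)" if "\<bar>y\<bar> < 1" for y :: real
    unfolding c_def by (rule mkz_powser_summable[OF that assms(3)])
  have x: "\<bar>x\<bar> < 1" using assms by auto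
  \<comment> \<open>The point \<open>(1 + x) / 2\<close> lies strictly between \<open>x\<close> and
    1; convergence there permits termwise differentiation at \<open>x\<close>.\<close>
  have dP: "(P has_real_derivative P') (at x)"
    unfolding P_def[abs_def] P'_def using x
    by (intro termdiffs_strong[of c "(1 + x) / 2"] c) (use assms in auto)
  have diffs: "summable (\<lambda>k. diffs c k * x ^ k)"
    using c x by (intro termdiff_converges[of x 1]) auto
  \<comment> \<open>The combination \<open>(1 - x) * P' - (n + 1) * P\<close> is what the product
    rule leaves after a factor \<open>(1 - x)^n\<close> is taken out.\<close>
  have "(\<lambda>k. diffs c k * x ^ k - real k * c k * x ^ k - real (n + 1) * (c k * x ^ k))
      sums (P' - x * P' - real (n + 1) * P x)"
  proof (intro sums_diff sums_mult)
    show "(\<lambda>k. diffs c k * x ^ k) sums P'" unfolding P'_def using diffs by (rule summable_sums)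
    have "(\<lambda>k. x * (real k * c k * x ^ (k - Suc 0))) sums (x * P')"
      unfolding P'_def using diffs_equiv[OF diffs] by (intro sums_mult)
    moreover have "x * (real k * c k * x ^ (k - Suc 0)) = real k * c k * x ^ k" for k
      by (cases k) simp_all
    ultimately show "(\<lambda>k. real k * c k * x ^ k) sums (x * P')" by simp
    show "(\<lambda>k. c k * x ^ k) sums P x" unfolding P_def by (rule summable_sums[OF c[OF x]])
  qed
  then have sums: "(\<lambda>k. (1 - x) ^ (n + 1) * (diffs c k * x ^ k - real k * c k * x ^ k - real (n + 1) * (c k * x ^ k)))
      sums ((1 - x) ^ (n + 1) * (P' - x * P' - real (n + 1) * P x))" by (rule sums_mult)
  have "(1 - x) ^ (n + 1) * (diffs c k * x ^ k - real k * c k * x ^ k - real (n + 1) * (c k * x ^ k))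
      = mkz_weight n x k * (real (n + 1 + k) * (g (Suc k) - g k))" for k
  proof -
    have "Suc k * (Suc (n + k) choose Suc k) = Suc (n + k) * ((n + k) choose k)"
      by (rule Suc_times_binomial)
    then have "real (Suc k) * real (Suc (n + k) choose Suc k) = real (n + 1 + k) * real ((n + k) choose k)"
      by (metis of_nat_mult add.commute add_Suc_right plus_1_eq_Suc add.assoc)
    then have "diffs c k = real (n + 1 + k) * real ((n + k) choose k) * g (Suc k)"
      unfolding diffs_def c_def add_Suc_right by (simp only: mult.assoc[symmetric])
    then show ?thesis unfolding mkz_weight_def c_def
      by (simp add: algebra_simps)
  qed
  with sums have mean: "mkz_mean n (\<lambda>k. real (n + 1 + k) * (g (Suc k) - g k)) x =
      (1 - x) ^ (n + 1) * (P' - x * P' - real (n + 1) * P x)"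
    unfolding mkz_mean_def by (simp add: sums_iff)
  have "((\<lambda>y. (1 - y) ^ (n + 1) * P y) has_real_derivative
      mkz_mean n (\<lambda>k. real (n + 1 + k) * (g (Suc k) - g k)) x / (1 - x)) (at x)"
  proof -
    have "((\<lambda>y. (1 - y) ^ (n + 1) * P y) has_real_derivative
        (real (n + 1) * (1 - x) ^ n * (-1)) * P x + (1 - x) ^ (n + 1) * P') (at x)"
      by (rule derivative_eq_intros dP refl | simp)+
    moreover have "(real (n + 1) * (1 - x) ^ n * (-1)) * P x + (1 - x) ^ (n + 1) * P' =
        mkz_mean n (\<lambda>k. real (n + 1 + k) * (g (Suc k) - g k)) x / (1 - x)"
      unfolding mean using assms(2) by (simp add: field_simps)
    ultimately show ?thesis by simp
  qed
  then show ?thesis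
  proof (rule has_field_derivative_transform_within_open[of _ _ _ "{-1<..<1}"])
    \<comment> \<open>The representation holds on both sides of 0, so the derivative at
      \<open>x = 0\<close> is two-sided.\<close>
    show "(1 - y) ^ (n + 1) * P y = mkz_mean n g y" if "y \<in> {-1<..<1}" for y
      using mkz_mean_powser[of y g B n, OF _ assms(3)] that by (auto simp: P_def c_def)
  qed (use assms in auto)
qed

lemma mkz_mean_abs_le:
  assumes "0 \<le> x" "x < 1" "\<And>k. \<bar>h k\<bar> \<le> C" "\<And>k. \<bar>g k\<bar> \<le> h k"
  shows "\<bar>mkz_mean n g x\<bar> \<le> mkz_mean n h x"
proof -
  have B: "\<bar>g k\<bar> \<le> C" for k using assms(3,4)[of k] by linarith
  have "mkz_mean n g x \<le> mkz_mean n h x"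
    using assms(4) by (intro mkz_mean_mono[OF assms(1,2) B assms(3)]) (simp add: abs_le_iff)
  moreover have "mkz_mean n (\<lambda>k. -1 * g k) x \<le> mkz_mean n h x"
    using assms(4) B by (intro mkz_mean_mono[OF assms(1,2) _ assms(3), of _ C]) (simp_all add: abs_le_iff)
  ultimately show ?thesis using mkz_mean_cmult[OF assms(1,2) B, of n "-1"] by simp
qed

lemma mkz_mean_node:
  assumes "0 \<le> x" "x < 1" "n \<noteq> 0"
  shows "mkz_mean n (mkz_node n) x = x"
  using mkz_mean_node_shift[of x "\<lambda>_. 1" 1 n] mkz_mean_const[of x n 1] assms by simp

lemma mkz_mean_affine_node:
  assumes "0 \<le> x" "x < 1" "n \<noteq> 0"
  shows "mkz_mean n (\<lambda>k. c + d * mkz_node n k) x = c + d * x"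
  using mkz_mean_linear[of x "\<lambda>_. 1" 1 "mkz_node n" 1 n c d] mkz_node_bounds[of n] assms
  by (simp add: mkz_mean_node mkz_mean_const)

section \<open>The Meyer-Koenig and Zeller operators\<close>

lemma MKZ_1 [simp]: "MKZ n f 1 = f 1"
  by (simp add: MKZ_def)

lemma MKZ_affine:
  assumes "x \<in> {0..1}" "n \<noteq> 0"
  shows "MKZ n (\<lambda>t. c + d * t) x = c + d * x"
  using assms by (cases "x = 1") (auto simp: MKZ_eq_mean mkz_mean_affine_node)

lemma MKZ_cong:
  assumes "\<And>t. t \<in> {0..1} \<Longrightarrow> f t = g t"
  shows "MKZ n f x = MKZ n g x"
  using assms mkz_node_bounds[of n] by (cases "x = 1") (auto simp: MKZ_eq_mean)

lemma MKZ_linear: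
  assumes "f \<in> C01" "g \<in> C01" "x \<in> {0..1}"
  shows "MKZ n (\<lambda>t. c * f t + d * g t) x = c * MKZ n f x + d * MKZ n g x"
proof -
  obtain B where "\<And>n k. \<bar>f (mkz_node n k)\<bar> \<le> B" using C01_bounded_node[OF assms(1)] by blast
  moreover obtain C where "\<And>n k. \<bar>g (mkz_node n k)\<bar> \<le> C" using C01_bounded_node[OF assms(2)] by blast
  ultimately show ?thesis
    using assms(3) mkz_mean_linear[of x "\<lambda>k. f (mkz_node n k)" B "\<lambda>k. g (mkz_node n k)" C n c d]
    by (cases "x = 1") (auto simp: MKZ_eq_mean)
qed

lemma MKZ_nonneg:
  assumes "f \<in> C01" "\<And>t. t \<in> {0..1} \<Longrightarrow> 0 \<le> f t" "x \<in> {0..1}"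
  shows "0 \<le> MKZ n f x"
proof (cases "x = 1")
  case False
  obtain B where B: "\<And>n k. \<bar>f (mkz_node n k)\<bar> \<le> B" using C01_bounded_node[OF assms(1)] by blast
  have "mkz_mean n (\<lambda>_. 0) x \<le> mkz_mean n (\<lambda>k. f (mkz_node n k)) x"
    using assms False mkz_node_bounds[of n] by (intro mkz_mean_mono[OF _ _ _ B, of _ _ 0]) auto
  then show ?thesis using False assms by (simp add: MKZ_eq_mean mkz_mean_const)
qed (use assms in auto)

text \<open>Below 1 continuity follows from differentiability of the mean. At 1 a Korovkin argument
  is used: \<open>f t - f 1\<close> is dominated by an affine function of \<open>t\<close>, whose
  mean is known exactly.\<close>

lemma MKZ_C01:
  assumes "f \<in> C01" "n \<noteq> 0"
  shows "MKZ n f \<in> C01"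
proof -
  obtain B where B: "\<And>t. t \<in> {0..1} \<Longrightarrow> \<bar>f t\<bar> \<le> B" using C01_bounded[OF assms(1)] by blast
  have node: "mkz_node n k \<in> {0..1}" for k using mkz_node_bounds[of n] by simp
  have Bn: "\<bar>f (mkz_node n k)\<bar> \<le> B" for k using B node by blast
  have "B \<ge> 0" using B[of 0] by simp
  have "continuous (at x within {0..1}) (MKZ n f)" if "0 \<le> x" "x < 1" for x
  proof -
    have "isCont (MKZ n f) x"
      by (rule DERIV_isCont, rule has_field_derivative_transform_within_open
          [OF mkz_mean_has_derivative[OF that Bn], of "{..<1}"])
        (use that in \<open>auto simp: MKZ_eq_mean\<close>)
    then show ?thesis by (rule continuous_at_imp_continuous_at_within)
  qed
  moreover have "continuous (at 1 within {0..1}) (MKZ n f)"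
    unfolding continuous_within_eps_delta
  proof (intro allI impI)
    fix \<epsilon> :: real assume "\<epsilon> > 0"
    have "continuous_on {0..1} f" using assms by (simp add: C01_def)
    then obtain \<delta> where \<delta>: "\<delta> > 0" "\<And>t. t \<in> {0..1} \<Longrightarrow> dist t 1 < \<delta> \<Longrightarrow> dist (f t) (f 1) < \<epsilon> / 2"
      using \<open>\<epsilon> > 0\<close> unfolding continuous_on_iff by (metis atLeastAtMost_iff half_gt_zero order_refl zero_le_one)
    \<comment> \<open>With this slope, \<open>K * (1 - t)\<close> exceeds the trivial bound
      \<open>2 * B\<close> on \<open>\<bar>f t - f 1\<bar>\<close> as soon as \<open>1 - t\<close>
      reaches \<delta>.\<close>
    define K where "K = 2 * B / \<delta>"
    have "K \<ge> 0" using \<open>B \<ge> 0\<close> \<delta> by (simp add: K_def)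
    have bound: "\<bar>f t - f 1\<bar> \<le> (\<epsilon> / 2 + K) + (- K) * t" if "t \<in> {0..1}" for t
    proof (cases "1 - t < \<delta>")
      case True
      then have "\<bar>f t - f 1\<bar> < \<epsilon> / 2" using \<delta>(2)[of t] that by (simp add: dist_real_def)
      moreover have "0 \<le> K * (1 - t)" using that \<open>K \<ge> 0\<close> by simp
      ultimately show ?thesis by (simp add: algebra_simps)
    next
      case False
      then have "K * \<delta> \<le> K * (1 - t)" using \<open>K \<ge> 0\<close> by (intro mult_left_mono) auto
      moreover have "K * \<delta> = 2 * B" using \<delta> by (simp add: K_def)
      ultimately show ?thesis using B[of t] B[of 1] that \<open>\<epsilon> > 0\<close>
        by (simp add: algebra_simps)
    qed
    have main: "\<bar>MKZ n f x - f 1\<bar> \<le> \<epsilon> / 2 + K * (1 - x)" if "0 \<le> x" "x < 1" for x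
    proof -
      have "MKZ n f x - f 1 = mkz_mean n (\<lambda>k. f (mkz_node n k) - f 1) x"
        using that mkz_mean_diff[of x "\<lambda>k. f (mkz_node n k)" B "\<lambda>_. f 1" "\<bar>f 1\<bar>" n, OF that Bn order_refl]
        by (simp add: MKZ_eq_mean mkz_mean_const)
      also have "\<bar>\<dots>\<bar> \<le> mkz_mean n (\<lambda>k. (\<epsilon> / 2 + K) + (- K) * mkz_node n k) x"
      proof (rule mkz_mean_abs_le[OF that])
        show "\<bar>f (mkz_node n k) - f 1\<bar> \<le> (\<epsilon> / 2 + K) + (- K) * mkz_node n k" for k
          by (rule bound[OF node])
        show "\<bar>(\<epsilon> / 2 + K) + (- K) * mkz_node n k\<bar> \<le> \<epsilon> / 2 + K" for k
        proof -
          have "K * mkz_node n k \<le> K * 1" using \<open>K \<ge> 0\<close> mkz_node_bounds[of n k] by (intro mult_left_mono) auto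
          moreover have "0 \<le> K * mkz_node n k" using \<open>K \<ge> 0\<close> mkz_node_bounds[of n k] by simp
          ultimately show ?thesis using \<open>\<epsilon> > 0\<close> by (simp add: abs_le_iff)
        qed
      qed
      also have "\<dots> = (\<epsilon> / 2 + K) + (- K) * x"
        using that assms(2) by (rule mkz_mean_affine_node)
      finally show ?thesis by (simp add: algebra_simps)
    qed
    \<comment> \<open>The denominator \<open>K + 1\<close> stays positive for \<open>K = 0\<close>
      and makes \<open>K * d\<close> strictly less than half of \<epsilon>.\<close>
    define d where "d = (\<epsilon> / 2) / (K + 1)"
    have "d > 0" using \<open>K \<ge> 0\<close> \<open>\<epsilon> > 0\<close> by (simp add: d_def)
    have "dist (MKZ n f x) (MKZ n f 1) < \<epsilon>" if "x \<in> {0..1}" "dist x 1 < d" for x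
    proof (cases "x = 1")
      case False
      then have "1 - x < d" "0 \<le> 1 - x" using that by (auto simp: dist_real_def)
      then have "K * (1 - x) \<le> K * d" using \<open>K \<ge> 0\<close> by (intro mult_left_mono) auto
      also have "K * d < (K + 1) * d" using \<open>d > 0\<close> by simp
      also have "(K + 1) * d = \<epsilon> / 2"
        using \<open>K \<ge> 0\<close> nonzero_mult_div_cancel_left[of "K + 1" "\<epsilon> / 2"] by (simp add: d_def)
      finally show ?thesis using main[of x] that False by (simp add: dist_real_def)
    qed (use \<open>\<epsilon> > 0\<close> in auto)
    then show "\<exists>d>0. \<forall>x\<in>{0..1}. dist x 1 < d \<longrightarrow> dist (MKZ n f x) (MKZ n f 1) < \<epsilon>"
      using \<open>d > 0\<close> by blast
  qed
  ultimately have "continuous (at x within {0..1}) (MKZ n f)" if "x \<in> {0..1}" for x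
    using that by (cases "x = 1") auto
  then show ?thesis
    unfolding C01_def continuous_on_eq_continuous_within by blast
qed

section \<open>Moments\<close>

text \<open>Index shift: \<open>mkz_var n\<close> belongs to the operator \<open>MKZ (Suc n)\<close>, and so do all quantities derived from it.\<close>

definition mkz_var :: "nat \<Rightarrow> real \<Rightarrow> real" where
  "mkz_var n = mkz_mean n (\<lambda>k. 1 / real (n + 2 + k))"

text \<open>Supplies the boundedness hypothesis of the mean lemmas. The convention
  \<open>1 / 0 = 0\<close> frees it of side conditions.\<close>

lemma inverse_nat_bound: "\<bar>1 / real (n + k)\<bar> \<le> 1"
  by (cases "n + k = 0") auto

lemma mkz_mean_0: "mkz_mean n g 0 = g 0"
proof -
  have "(\<Sum>k. mkz_weight n 0 k * g k) = (\<Sum>k\<in>{0}. mkz_weight n 0 k * g k)"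
    by (rule suminf_finite) (auto simp: mkz_weight_def)
  then show ?thesis by (simp add: mkz_mean_def mkz_weight_def)
qed

lemma mkz_var_0: "mkz_var n 0 = 1 / (real n + 2)"
  by (simp add: mkz_var_def mkz_mean_0 add_ac)

lemma mkz_var_1: "mkz_var n 1 = 0"
  by (simp add: mkz_var_def mkz_mean_def mkz_weight_def)

text \<open>The co-node shift applied to the constant 1.\<close>

lemma mkz_mean_inverse:
  assumes "0 \<le> x" "x < 1" "n \<noteq> 0"
  shows "mkz_mean n (\<lambda>k. 1 / real (n + k)) x = (1 - x) / real n"
proof -
  obtain m where n: "n = Suc m" using assms(3) by (cases n) auto
  have "real n * mkz_mean n (\<lambda>k. 1 / real (n + k)) x = mkz_mean n (\<lambda>k. real n * (1 / real (n + k))) x"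
    by (rule mkz_mean_cmult[OF assms(1,2) inverse_nat_bound, symmetric])
  also have "\<dots> = 1 - x"
    using mkz_mean_co_node[of x "\<lambda>_. 1" 1 m] mkz_mean_const[of x m 1] assms by (simp add: n)
  finally show ?thesis using assms(3) by (simp add: field_simps)
qed

text \<open>
  The mean of \<open>1 / (n + k)\<close> is known exactly, so \<open>mkz_var\<close> is estimated by comparing \<open>1 / (n + 2 + k)\<close>
  termwise with multiples of \<open>1 / (n + k)\<close>.
\<close>

lemma mkz_var_lower:
  assumes "x \<in> {0..1}" "n \<noteq> 0"
  shows "(1 - x) / (real n + 2) \<le> mkz_var n x"
proof (cases "x = 1")
  case False
  then have x: "0 \<le> x" "x < 1" using assms by auto
  let ?c = "real n / (real n + 2)"
  have c: "\<bar>?c * (1 / real (n + k))\<bar> \<le> 1" for k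
  proof -
    have "\<bar>?c\<bar> * \<bar>1 / real (n + k)\<bar> \<le> 1 * 1"
      by (intro mult_mono inverse_nat_bound) auto
    then show ?thesis by (simp only: abs_mult mult_1)
  qed
  have le: "?c * (1 / real (n + k)) \<le> 1 / real (n + 2 + k)" for k
  proof -
    define q where "q = real (n + k)"
    have q: "real n \<le> q" "0 < q" using assms(2) by (auto simp: q_def)
    \<comment> \<open>The map sending \<open>q\<close> to \<open>q / (q + 2)\<close> is increasing
      and \<open>q\<close> is at least \<open>n\<close>.\<close>
    have "?c \<le> q / (q + 2)" using q by (simp add: divide_le_eq le_divide_eq algebra_simps)
    then have "?c * (1 / q) \<le> q / (q + 2) * (1 / q)" using q by (intro mult_right_mono) auto
    also have "\<dots> = 1 / real (n + 2 + k)" using q by (simp add: q_def)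
    finally show ?thesis by (simp only: q_def)
  qed
  have "?c * ((1 - x) / real n) = mkz_mean n (\<lambda>k. ?c * (1 / real (n + k))) x"
    using mkz_mean_cmult[OF x inverse_nat_bound[of n], of n ?c] mkz_mean_inverse[OF x assms(2)] by simp
  also have "\<dots> \<le> mkz_var n x"
    unfolding mkz_var_def by (rule mkz_mean_mono[OF x c inverse_nat_bound le])
  finally show ?thesis using assms(2) by simp
qed (simp add: mkz_var_1)

lemma mkz_var_upper:
  assumes "x \<in> {0..1}" "n \<noteq> 0"
  shows "mkz_var n x \<le> (1 - x) / real n"
proof (cases "x = 1")
  case False
  then have x: "0 \<le> x" "x < 1" using assms by auto
  have "mkz_var n x \<le> mkz_mean n (\<lambda>k. 1 / real (n + k)) x"
    unfolding mkz_var_def using assms(2)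
    by (intro mkz_mean_mono[OF x inverse_nat_bound inverse_nat_bound]) (simp add: frac_le)
  then show ?thesis by (simp only: mkz_mean_inverse[OF x assms(2)])
qed (simp add: mkz_var_1)

lemma mkz_var_le_inverse:
  assumes "0 \<le> x" "x < 1"
  shows "mkz_var n x \<le> 1 / (real n + 1)"
proof -
  have "mkz_var n x \<le> mkz_mean n (\<lambda>_. 1 / (real n + 1)) x"
    unfolding mkz_var_def
    by (intro mkz_mean_mono[OF assms inverse_nat_bound order_refl]) (simp add: frac_le)
  then show ?thesis by (simp add: mkz_mean_const assms)
qed

lemma mkz_var_nonneg:
  assumes "0 \<le> x" "x < 1"
  shows "0 \<le> mkz_var n x"
proof -
  have "mkz_mean n (\<lambda>_. 0) x \<le> mkz_var n x"
    unfolding mkz_var_def by (rule mkz_mean_mono[OF assms _ inverse_nat_bound, of _ 0]) auto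
  then show ?thesis by (simp add: mkz_mean_const assms)
qed

section \<open>Lipschitz estimate for the variance factor minus its chord\<close>

lemma inverse_increment_bound:
  fixes N q :: real
  assumes "1 \<le> N" "N \<le> q"
  shows "\<bar>- ((q + 1) / ((q + 2) * (q + 3))) + N / ((N + 2) * q)\<bar> \<le> 2 / ((N + 2) * q)"
proof -
  \<comment> \<open>Chosen so that the expression inside the absolute value becomes
    \<open>(r - 2) / ((N + 2) * q)\<close>; the claim then reduces to \<open>r\<close> lying between
    0 and 4.\<close>
  define r where "r = (N + 2) * ((4 * q + 6) / ((q + 2) * (q + 3)))"
  have "r \<le> (q + 2) * ((4 * q + 6) / ((q + 2) * (q + 3)))"
    unfolding r_def using assms by (intro mult_right_mono) auto
  also have "\<dots> = (4 * q + 6) / (q + 3)" using assms by simp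
  also have "\<dots> \<le> 4" using assms by (simp add: divide_le_eq)
  finally have "r \<le> 4" .
  moreover have "0 \<le> r" unfolding r_def using assms by simp
  ultimately have r: "\<bar>r - 2\<bar> \<le> 2" by linarith
  have "(q + 1) / ((q + 2) * (q + 3)) = (1 - (4 * q + 6) / ((q + 2) * (q + 3))) / q"
    using assms by (simp add: divide_simps) (simp add: algebra_simps)
  moreover have "\<dots> = ((N + 2) - r) / ((N + 2) * q)"
    using assms by (simp add: r_def divide_simps) (simp add: algebra_simps)
  ultimately have "- ((q + 1) / ((q + 2) * (q + 3))) + N / ((N + 2) * q) = (r - 2) / ((N + 2) * q)"
    by (simp add: diff_divide_distrib add_divide_distrib)
  then show ?thesis using r assms by (simp add: divide_right_mono)
qed

text \<open>The subtracted affine function is the chord of \<open>mkz_var n\<close> between 0 and 1.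
  The result is the remainder \<open>R\<close> of the overview at index
  \<open>Suc n\<close>.\<close>

definition mkz_excess :: "nat \<Rightarrow> real \<Rightarrow> real" where
  "mkz_excess n x = mkz_var n x - (1 - x) / (real n + 2)"

lemma mkz_excess_nonneg: "x \<in> {0..1} \<Longrightarrow> n \<noteq> 0 \<Longrightarrow> 0 \<le> mkz_excess n x"
  using mkz_var_lower[of x n] by (simp add: mkz_excess_def)

lemma mkz_excess_0: "mkz_excess n 0 = 0" and mkz_excess_1: "mkz_excess n 1 = 0"
  by (simp_all add: mkz_excess_def mkz_var_0 mkz_var_1)

text \<open>After multiplication by \<open>1 - x\<close>, the whole derivative is a single mean,
  bounded termwise by a multiple of \<open>1 / (n + k)\<close>. The mean of that bound has the
  factor \<open>1 - x\<close> again, which cancels and leaves a bound uniform up to 1.\<close>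

lemma mkz_excess_has_bounded_derivative:
  assumes "0 \<le> x" "x < 1" "n \<noteq> 0"
  obtains D where "(mkz_excess n has_real_derivative D) (at x)"
    "\<bar>D\<bar> \<le> 2 / (real n * (real n + 2))"
proof -
  let ?N = "real n"
  define h where "h k = real (n + 1 + k) * (1 / real (n + 2 + Suc k) - 1 / real (n + 2 + k))" for k
  have N: "1 \<le> ?N" using assms(3) by simp
  have q: "?N \<le> real (n + k)" for k by simp
  have h: "h k = - ((real (n + k) + 1) / ((real (n + k) + 2) * (real (n + k) + 3)))" for k
    unfolding h_def by (simp add: divide_simps) (simp add: algebra_simps)
  have hB: "\<bar>h k\<bar> \<le> 1" for k
  proof -
    have "real (n + k) + 1 \<le> (real (n + k) + 2) * (real (n + k) + 3)"
      by (simp add: algebra_simps)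
    then show ?thesis unfolding h abs_minus_cancel by (simp add: divide_le_eq)
  qed
  define D where "D = mkz_mean n h x / (1 - x) + 1 / (?N + 2)"
  have "(mkz_excess n has_real_derivative mkz_mean n h x / (1 - x) - (0 - 1) / (?N + 2)) (at x)"
    unfolding mkz_excess_def[abs_def] mkz_var_def h_def
    by (intro DERIV_diff DERIV_cdivide DERIV_const DERIV_ident
        mkz_mean_has_derivative[OF assms(1,2) inverse_nat_bound])
  then have "(mkz_excess n has_real_derivative D) (at x)" by (simp add: D_def)
  moreover have "\<bar>D\<bar> \<le> 2 / (?N * (?N + 2))"
  proof -
    let ?c = "?N / (?N + 2)" and ?d = "2 / (?N + 2)"
    let ?g = "\<lambda>k. 1 / real (n + k)"
    \<comment> \<open>The chord contributes \<open>(1 - x) / (n + 2)\<close>, rewritten as a mean by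
      means of \<open>mkz_mean_inverse\<close>.\<close>
    have "(1 - x) * D = mkz_mean n h x + ?c * mkz_mean n ?g x"
      unfolding mkz_mean_inverse[OF assms] D_def using assms by (simp add: distrib_left)
    also have "\<dots> = mkz_mean n (\<lambda>k. 1 * h k + ?c * ?g k) x"
      using mkz_mean_linear[of x h 1 ?g 1 n 1 ?c, OF assms(1,2) hB inverse_nat_bound] by simp
    also have "\<bar>\<dots>\<bar> \<le> mkz_mean n (\<lambda>k. ?d * ?g k) x"
    proof (rule mkz_mean_abs_le[OF assms(1,2)])
      show "\<bar>1 * h k + ?c * ?g k\<bar> \<le> ?d * ?g k" for k
        using inverse_increment_bound[OF N q, of k] by (simp add: h)
      show "\<bar>?d * ?g k\<bar> \<le> 1" for k
      proof -
        have "\<bar>?d\<bar> * \<bar>?g k\<bar> \<le> 1 * 1" by (intro mult_mono inverse_nat_bound) auto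
        then show ?thesis by (simp only: abs_mult mult_1)
      qed
    qed
    also have "\<dots> = (1 - x) * (2 / (?N * (?N + 2)))"
      using mkz_mean_cmult[of x ?g 1 n ?d, OF assms(1,2) inverse_nat_bound] mkz_mean_inverse[OF assms]
      by (simp add: mult_ac)
    finally have "(1 - x) * \<bar>D\<bar> \<le> (1 - x) * (2 / (?N * (?N + 2)))" using assms by (simp add: abs_mult)
    then show ?thesis by (rule mult_left_le_imp_le) (use assms in simp)
  qed
  ultimately show thesis by (rule that)
qed

text \<open>For end points below 1 this is the mean value theorem. If one of them is 1, the
  two-sided bounds on \<open>mkz_var\<close> replace it, since \<open>1 / n - 1 / (n + 2)\<close>
  equals the same constant.\<close>

lemma mkz_excess_lipschitz:
  assumes "x \<in> {0..1}" "y \<in> {0..1}" "n \<noteq> 0"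
  shows "\<bar>mkz_excess n x - mkz_excess n y\<bar> \<le> 2 / (real n * (real n + 2)) * \<bar>x - y\<bar>"
proof -
  let ?K = "2 / (real n * (real n + 2))"
  have less: "\<bar>mkz_excess n x - mkz_excess n y\<bar> \<le> ?K * \<bar>x - y\<bar>"
    if "0 \<le> x" "x < y" "y \<le> 1" for x y
  proof (cases "y = 1")
    case True
    have "\<bar>mkz_excess n x\<bar> = mkz_var n x - (1 - x) / (real n + 2)"
      using mkz_excess_nonneg[of x n] that assms(3) by (simp add: mkz_excess_def)
    also have "\<dots> \<le> (1 - x) / real n - (1 - x) / (real n + 2)"
      using mkz_var_upper[of x n] that assms(3) by simp
    also have "\<dots> = ?K * (1 - x)"
      using assms(3) by (simp add: divide_simps) (simp add: algebra_simps)
    finally show ?thesis using True that by (simp add: mkz_excess_1)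
  next
    case False
    have "\<exists>D. (mkz_excess n has_real_derivative D) (at z) \<and> \<bar>D\<bar> \<le> ?K" if "0 \<le> z" "z < 1" for z
      using mkz_excess_has_bounded_derivative[OF that assms(3)] by blast
    then obtain D where D: "\<And>z. 0 \<le> z \<Longrightarrow> z < 1 \<Longrightarrow> (mkz_excess n has_real_derivative D z) (at z)"
        "\<And>z. 0 \<le> z \<Longrightarrow> z < 1 \<Longrightarrow> \<bar>D z\<bar> \<le> ?K" by metis
    have "\<exists>z>x. z < y \<and> mkz_excess n y - mkz_excess n x = (y - x) * D z"
      using that False by (intro MVT2 D(1)) auto
    then obtain z where z: "x < z" "z < y" "mkz_excess n y - mkz_excess n x = (y - x) * D z"
      by blast
    have "\<bar>mkz_excess n x - mkz_excess n y\<bar> = \<bar>D z\<bar> * \<bar>x - y\<bar>"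
      using arg_cong[OF z(3), of abs] by (simp add: abs_mult abs_minus_commute)
    also have "\<dots> \<le> ?K * \<bar>x - y\<bar>" using D(2)[of z] z that by (intro mult_right_mono) auto
    finally show ?thesis .
  qed
  consider "x < y" | "x = y" | "y < x" by linarith
  then show ?thesis
    using less[of x y] less[of y x] assms by cases (auto simp: abs_minus_commute)
qed

section \<open>Second and fourth central moments\<close>

lemma mkz_mean_node_deviation:
  assumes "0 \<le> x" "x < 1" "n \<noteq> 0" "\<And>k. \<bar>g k\<bar> \<le> B"
  shows "mkz_mean n (\<lambda>k. (mkz_node n k - x) * g k) x = x * mkz_mean n (\<lambda>k. g (Suc k) - g k) x"
proof -
  have B: "\<bar>mkz_node n k * g k\<bar> \<le> 1 * B" for k
    unfolding abs_mult using mkz_node_bounds[of n k] assms(4)[of k] by (intro mult_mono) auto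
  have "mkz_mean n (\<lambda>k. (mkz_node n k - x) * g k) x = mkz_mean n (\<lambda>k. 1 * (mkz_node n k * g k) + (- x) * g k) x"
    by (simp add: algebra_simps)
  also have "\<dots> = 1 * mkz_mean n (\<lambda>k. mkz_node n k * g k) x + (- x) * mkz_mean n g x"
    by (rule mkz_mean_linear[OF assms(1,2) B assms(4)])
  also have "\<dots> = x * (mkz_mean n (\<lambda>k. g (Suc k)) x - mkz_mean n g x)"
    unfolding mkz_mean_node_shift[OF assms(1,2,4,3)] by (simp add: right_diff_distrib)
  finally show ?thesis by (simp add: mkz_mean_diff[OF assms(1,2,4,4)])
qed

text \<open>The increment is factored so that its first factor is
  \<open>1 - mkz_node (Suc n) k\<close>, the form that \<open>mkz_mean_co_node\<close>
  consumes.\<close>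

lemma mkz_node_step:
  "mkz_node (Suc n) (Suc k) - mkz_node (Suc n) k = real (Suc n) / real (Suc n + k) * (1 / real (n + 2 + k))"
  by (simp add: mkz_node_def divide_simps) (simp add: algebra_simps)

lemma one_minus_mkz_node: "1 - mkz_node (Suc n) k = real (Suc n) / real (Suc n + k)"
  by (simp add: mkz_node_def divide_simps)

text \<open>One deviation factor becomes the node increment, and the co-node shift then lowers the
  order to \<open>n\<close>; hence the index of \<open>mkz_var\<close>.\<close>

lemma mkz_second_moment:
  assumes "0 \<le> x" "x < 1"
  shows "mkz_mean (Suc n) (\<lambda>k. (mkz_node (Suc n) k - x)\<^sup>2) x = psi x * mkz_var n x"
proof -
  have B: "\<bar>mkz_node (Suc n) k - x\<bar> \<le> 1" for k using mkz_node_bounds[of "Suc n" k] assms by simp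
  have "mkz_mean (Suc n) (\<lambda>k. (mkz_node (Suc n) k - x)\<^sup>2) x =
      x * mkz_mean (Suc n) (\<lambda>k. mkz_node (Suc n) (Suc k) - mkz_node (Suc n) k) x"
    using mkz_mean_node_deviation[OF assms _ B, of "Suc n"] by (simp add: power2_eq_square)
  also have "\<dots> = x * ((1 - x) * mkz_var n x)"
    unfolding mkz_node_step mkz_var_def
    by (subst mkz_mean_co_node[OF assms inverse_nat_bound]) simp
  finally show ?thesis by (simp add: psi_def)
qed

text \<open>One deviation factor turns the fourth power into the increment of a cube. That increment
  is bounded by a second-moment term with coefficient 3 and a term in \<open>1 - t\<close> with
  coefficient 4, whence the 7.\<close>

lemma mkz_fourth_moment:
  assumes "0 \<le> x" "x < 1"
  shows "mkz_mean (Suc n) (\<lambda>k. (mkz_node (Suc n) k - x) ^ 4) x \<le> 7 / (real (Suc n))\<^sup>2 * psi x"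
proof -
  let ?n = "real (Suc n)"
  let ?d = "\<lambda>k. mkz_node (Suc n) k - x"
  let ?c = "\<lambda>k. 1 - mkz_node (Suc n) k"
  have d: "\<bar>?d k\<bar> \<le> 1" for k using mkz_node_bounds[of "Suc n" k] assms by simp
  have d2: "\<bar>(?d k)\<^sup>2\<bar> \<le> 1" and d3: "\<bar>(?d k) ^ 3\<bar> \<le> 1" for k
    using power_mono[OF d, of k 2] power_mono[OF d, of k 3] by (simp_all add: power_abs)
  have c: "\<bar>?c k\<bar> \<le> 1" for k using mkz_node_bounds[of "Suc n" k] by simp
  have step: "?d (Suc k) ^ 3 - ?d k ^ 3 \<le> 3 / ?n * (?d k)\<^sup>2 + 4 / ?n\<^sup>2 * ?c k" for k
  proof -
    define s where "s = mkz_node (Suc n) (Suc k) - mkz_node (Suc n) k"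
    have s_eq: "s = ?c k * (1 / real (n + 2 + k))"
      by (simp only: s_def mkz_node_step one_minus_mkz_node)
    have c01: "0 \<le> ?c k" "?c k \<le> 1" using mkz_node_bounds[of "Suc n" k] by auto
    have s0: "0 \<le> s" using c01 unfolding s_eq by simp
    have s1: "s \<le> ?c k * (1 / ?n)" unfolding s_eq using c01 by (intro mult_left_mono frac_le) auto
    also have "\<dots> \<le> 1 * (1 / ?n)" using c01 by (intro mult_right_mono) auto
    finally have s2: "s \<le> 1 / ?n" by simp
    also have "\<dots> \<le> 1" by simp
    finally have s3: "s \<le> 1" .
    \<comment> \<open>Expansion of \<open>(d + s)^3 - d^3\<close>, where \<open>3 * d + s\<close> is
      at most 4. In the quadratic part one factor \<open>s\<close> keeps \<open>1 - t\<close>, whose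
      mean supplies the \<open>1 - x\<close> needed for \<open>psi x\<close>; the other is bounded
      by \<open>1 / ?n\<close>.\<close>
    have "?d (Suc k) ^ 3 - ?d k ^ 3 = s * (3 * (?d k)\<^sup>2) + s * (s * (3 * ?d k + s))"
      unfolding s_def by (simp add: power2_eq_square power3_eq_cube algebra_simps)
    moreover have "s * (3 * (?d k)\<^sup>2) \<le> 1 / ?n * (3 * (?d k)\<^sup>2)"
      using s2 by (intro mult_right_mono) auto
    moreover have "s * (s * (3 * ?d k + s)) \<le> s * (s * 4)"
      using d[of k] s0 s3 by (intro mult_left_mono) auto
    moreover have "s * (s * 4) \<le> (?c k * (1 / ?n)) * ((1 / ?n) * 4)"
      using s0 s1 s2 c01 by (intro mult_mono mult_right_mono) auto
    moreover have "1 / ?n * (3 * u) + (v * (1 / ?n)) * ((1 / ?n) * 4) = 3 / ?n * u + 4 / ?n\<^sup>2 * v" for u v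
      by (simp add: power2_eq_square)
    note this[of "(?d k)\<^sup>2" "?c k"]
    ultimately show ?thesis by linarith
  qed
  have bd: "\<bar>3 / ?n * (?d k)\<^sup>2 + 4 / ?n\<^sup>2 * ?c k\<bar> \<le> 3 / ?n + 4 / ?n\<^sup>2" for k
  proof -
    have "\<bar>3 / ?n * (?d k)\<^sup>2\<bar> \<le> 3 / ?n * 1" "\<bar>4 / ?n\<^sup>2 * ?c k\<bar> \<le> 4 / ?n\<^sup>2 * 1"
      unfolding abs_mult using d2[of k] c[of k] by (intro mult_mono; simp)+
    then show ?thesis by linarith
  qed
  have diff: "\<bar>?d (Suc k) ^ 3 - ?d k ^ 3\<bar> \<le> 2" for k using d3[of "Suc k"] d3[of k] by linarith
  have "mkz_mean (Suc n) (\<lambda>k. ?d k ^ 4) x = x * mkz_mean (Suc n) (\<lambda>k. ?d (Suc k) ^ 3 - ?d k ^ 3) x"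
    using mkz_mean_node_deviation[OF assms _ d3, of "Suc n"] by (simp add: eval_nat_numeral)
  also have "\<dots> \<le> x * mkz_mean (Suc n) (\<lambda>k. 3 / ?n * (?d k)\<^sup>2 + 4 / ?n\<^sup>2 * ?c k) x"
    by (intro mult_left_mono mkz_mean_mono[OF assms diff bd step] assms(1))
  also have "\<dots> = x * (3 / ?n * (psi x * mkz_var n x) + 4 / ?n\<^sup>2 * (1 - x))"
    using mkz_mean_linear[of x "\<lambda>k. (?d k)\<^sup>2" 1 ?c 1 "Suc n" "3 / ?n" "4 / ?n\<^sup>2", OF assms d2 c]
      mkz_mean_affine_node[OF assms, of "Suc n" 1 "-1"] mkz_second_moment[OF assms, of n]
    by simp
  also have "\<dots> \<le> x * (3 / ?n * ((1 - x) * (1 / ?n)) + 4 / ?n\<^sup>2 * (1 - x))"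
  proof -
    \<comment> \<open>Only \<open>1 - x\<close> is kept of \<open>psi x\<close>: the outer factor
      \<open>x\<close> restores \<open>psi x\<close> at the end.\<close>
    have "psi x * mkz_var n x \<le> (1 - x) * (1 / ?n)"
      using mkz_var_le_inverse[OF assms, of n] assms
      by (intro mult_mono mkz_var_nonneg) (auto simp: psi_def mult_le_cancel_right1 add.commute)
    then show ?thesis using assms by (intro mult_left_mono add_right_mono) auto
  qed
  also have "\<dots> = 7 / ?n\<^sup>2 * psi x"
  proof -
    have "3 / m * (u * (1 / m)) + 4 / m\<^sup>2 * u = 7 / m\<^sup>2 * u" for m u :: real
      by (simp add: power2_eq_square flip: add_divide_distrib)
    then show ?thesis by (simp only: psi_def mult.left_commute)
  qed
  finally show ?thesis .
qed

section \<open>The symmetrized operators\<close>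

lemma MKZ_second_moment:
  assumes "x \<in> {0..1}"
  shows "MKZ (Suc n) (\<lambda>t. (t - x)\<^sup>2) x = psi x * mkz_var n x"
  using assms by (cases "x = 1") (auto simp: MKZ_eq_mean mkz_second_moment psi_def)

lemma MKZ_fourth_moment:
  assumes "x \<in> {0..1}"
  shows "MKZ (Suc n) (\<lambda>t. (t - x) ^ 4) x \<le> 7 / (real (Suc n))\<^sup>2 * psi x"
proof (cases "x = 1")
  case False
  then show ?thesis using mkz_fourth_moment[of x n] assms by (simp add: MKZ_eq_mean)
qed (simp add: psi_def)

lemma MKZ_star_eq: "MKZ_star n f x = (MKZ n f x + MKZ n (\<lambda>t. f (1 - t)) (1 - x)) / 2"
  by (simp add: MKZ_star_def MKZ_reflected_def o_def tau_def e_def)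

lemma C01_reflect:
  assumes "f \<in> C01"
  shows "(\<lambda>t. f (1 - t)) \<in> C01"
proof -
  have "continuous_on {0..1} (\<lambda>t. f (1 - t))"
    by (rule continuous_on_compose2[of "{0..1}" f]) (use assms in \<open>auto simp: C01_def intro!: continuous_intros\<close>)
  then show ?thesis by (simp add: C01_def)
qed

lemma MKZ_star_linear:
  assumes "f \<in> C01" "g \<in> C01" "x \<in> {0..1}"
  shows "MKZ_star n (\<lambda>t. c * f t + d * g t) x = c * MKZ_star n f x + d * MKZ_star n g x"
proof -
  have "1 - x \<in> {0..1}" using assms by auto
  then show ?thesis
    unfolding MKZ_star_eq MKZ_linear[OF assms]
      MKZ_linear[OF C01_reflect[OF assms(1)] C01_reflect[OF assms(2)] \<open>1 - x \<in> {0..1}\<close>]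
    by (simp add: distrib_left add_divide_distrib)
qed

lemma MKZ_star_cong:
  assumes "\<And>t. t \<in> {0..1} \<Longrightarrow> f t = g t"
  shows "MKZ_star n f x = MKZ_star n g x"
proof -
  have "MKZ n f x = MKZ n g x" by (rule MKZ_cong[OF assms])
  moreover have "MKZ n (\<lambda>t. f (1 - t)) (1 - x) = MKZ n (\<lambda>t. g (1 - t)) (1 - x)"
    by (rule MKZ_cong) (simp add: assms)
  ultimately show ?thesis by (simp add: MKZ_star_eq)
qed

lemma MKZ_star_nonneg:
  assumes "f \<in> C01" "\<And>t. t \<in> {0..1} \<Longrightarrow> 0 \<le> f t" "x \<in> {0..1}"
  shows "0 \<le> MKZ_star n f x"
proof -
  have "0 \<le> MKZ n f x" by (rule MKZ_nonneg[OF assms])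
  moreover have "0 \<le> MKZ n (\<lambda>t. f (1 - t)) (1 - x)"
    by (rule MKZ_nonneg[OF C01_reflect[OF assms(1)]]) (use assms in auto)
  ultimately show ?thesis by (simp add: MKZ_star_eq)
qed

lemma MKZ_star_C01:
  assumes "f \<in> C01" "n \<noteq> 0"
  shows "MKZ_star n f \<in> C01"
proof -
  have "MKZ n f \<in> C01" "(\<lambda>x. MKZ n (\<lambda>t. f (1 - t)) (1 - x)) \<in> C01"
    using assms by (auto intro: MKZ_C01 C01_reflect)
  then show ?thesis unfolding C01_def MKZ_star_eq[abs_def] by (auto intro!: continuous_intros)
qed

lemma MKZ_star_mono:
  assumes "f \<in> C01" "g \<in> C01" "\<And>t. t \<in> {0..1} \<Longrightarrow> f t \<le> g t" "x \<in> {0..1}"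
  shows "MKZ_star n f x \<le> MKZ_star n g x"
proof -
  have "(\<lambda>t. 1 * g t + (-1) * f t) \<in> C01"
    using assms by (auto simp: C01_def intro!: continuous_intros)
  then have "0 \<le> MKZ_star n (\<lambda>t. 1 * g t + (-1) * f t) x"
    using assms by (intro MKZ_star_nonneg) auto
  then show ?thesis unfolding MKZ_star_linear[OF assms(2,1,4)] by simp
qed

lemma MKZ_star_affine:
  assumes "x \<in> {0..1}" "n \<noteq> 0"
  shows "MKZ_star n (\<lambda>t. c + d * t) x = c + d * x"
proof -
  have "MKZ n (\<lambda>t. c + d * (1 - t)) (1 - x) = MKZ n (\<lambda>t. (c + d) + (- d) * t) (1 - x)"
    by (simp add: algebra_simps)
  also have "\<dots> = (c + d) + (- d) * (1 - x)"
    by (rule MKZ_affine) (use assms in auto)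
  finally show ?thesis unfolding MKZ_star_eq MKZ_affine[OF assms] by (simp add: algebra_simps)
qed

text \<open>Closed form of \<open>alpha (MKZ_star (Suc n))\<close>: the average of
  \<open>mkz_var n\<close> at \<open>x\<close> and \<open>1 - x\<close>. The two chords sum to the
  constant \<open>1 / (n + 2)\<close>, so lower and Lipschitz bounds can be read off the
  excess.\<close>

definition star_alpha :: "nat \<Rightarrow> real \<Rightarrow> real" where
  "star_alpha n x = 1 / (2 * (real n + 2)) + (mkz_excess n x + mkz_excess n (1 - x)) / 2"

text \<open>Reflection turns the moment about \<open>x\<close> into the moment about
  \<open>1 - x\<close>, and \<open>psi\<close> is symmetric.\<close>

lemma MKZ_star_second_moment:
  assumes "x \<in> {0..1}"
  shows "MKZ_star (Suc n) (\<lambda>t. (t - x)\<^sup>2) x = star_alpha n x * psi x"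
proof -
  have "(\<lambda>t. (1 - t - x)\<^sup>2) = (\<lambda>t. (t - (1 - x))\<^sup>2)" by (simp add: power2_eq_square algebra_simps)
  then have "MKZ_star (Suc n) (\<lambda>t. (t - x)\<^sup>2) x = (psi x * mkz_var n x + psi (1 - x) * mkz_var n (1 - x)) / 2"
    using MKZ_second_moment[of x n] MKZ_second_moment[of "1 - x" n] assms by (simp add: MKZ_star_eq)
  also have "psi (1 - x) = psi x" by (simp add: psi_def)
  also have "(psi x * mkz_var n x + psi x * mkz_var n (1 - x)) / 2 = star_alpha n x * psi x"
  proof -
    have "star_alpha n x = (mkz_var n x + mkz_var n (1 - x)) / 2"
      unfolding star_alpha_def mkz_excess_def by (simp add: divide_simps) (simp add: algebra_simps)
    then show ?thesis by (simp add: algebra_simps)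
  qed
  finally show ?thesis .
qed

lemma MKZ_star_fourth_moment:
  assumes "x \<in> {0..1}"
  shows "MKZ_star (Suc n) (\<lambda>t. (t - x) ^ 4) x \<le> 7 / (real (Suc n))\<^sup>2 * psi x"
proof -
  have "(1 - t - x) ^ 4 = (t - (1 - x)) ^ 4" for t
  proof -
    have "(1 - t - x) ^ 4 = (- (t - (1 - x))) ^ 4" by (rule arg_cong[of _ _ "\<lambda>u. u ^ 4"]) simp
    also have "\<dots> = (t - (1 - x)) ^ 4" by (rule power_minus_even) simp
    finally show ?thesis .
  qed
  then have "MKZ_star (Suc n) (\<lambda>t. (t - x) ^ 4) x =
      (MKZ (Suc n) (\<lambda>t. (t - x) ^ 4) x + MKZ (Suc n) (\<lambda>t. (t - (1 - x)) ^ 4) (1 - x)) / 2"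
    by (simp only: MKZ_star_eq)
  also have "\<dots> \<le> (7 / (real (Suc n))\<^sup>2 * psi x + 7 / (real (Suc n))\<^sup>2 * psi (1 - x)) / 2"
    by (intro divide_right_mono add_mono MKZ_fourth_moment) (use assms in auto)
  also have "\<dots> = 7 / (real (Suc n))\<^sup>2 * psi x" by (simp add: psi_def mult.commute)
  finally show ?thesis .
qed

lemma psi_C01: "psi \<in> C01"
  by (auto simp: C01_def psi_def[abs_def] intro!: continuous_intros)

lemma psi_pos: "x \<in> {0<..<1} \<Longrightarrow> 0 < psi x"
  by (simp add: psi_def)

lemma psi_nonneg: "x \<in> {0..1} \<Longrightarrow> 0 \<le> psi x"
  by (simp add: psi_def)

text \<open>The parabola \<open>psi\<close> is its tangent at \<open>x\<close> minus
  \<open>(t - x)^2\<close>; the tangent is reproduced and the square gives the second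
  moment.\<close>

lemma MKZ_star_psi:
  assumes "x \<in> {0..1}"
  shows "MKZ_star (Suc n) psi x = (1 - star_alpha n x) * psi x"
proof -
  have "psi = (\<lambda>t. 1 * (x\<^sup>2 + (1 - 2 * x) * t) + (-1) * (t - x)\<^sup>2)"
    by (rule ext) (simp add: psi_def power2_eq_square algebra_simps)
  then have "MKZ_star (Suc n) psi x = MKZ_star (Suc n) (\<lambda>t. 1 * (x\<^sup>2 + (1 - 2 * x) * t) + (-1) * (t - x)\<^sup>2) x"
    by simp
  also have "\<dots> = 1 * MKZ_star (Suc n) (\<lambda>t. x\<^sup>2 + (1 - 2 * x) * t) x + (-1) * MKZ_star (Suc n) (\<lambda>t. (t - x)\<^sup>2) x"
    using assms by (intro MKZ_star_linear) (auto simp: C01_def intro!: continuous_intros)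
  also have "\<dots> = x\<^sup>2 + (1 - 2 * x) * x - star_alpha n x * psi x"
    using assms by (simp add: MKZ_star_affine MKZ_star_second_moment)
  finally show ?thesis by (simp add: psi_def power2_eq_square algebra_simps)
qed

lemma star_alpha_lower:
  assumes "x \<in> {0..1}" "n \<noteq> 0"
  shows "1 / (2 * (real n + 2)) \<le> star_alpha n x"
  using mkz_excess_nonneg[of x n] mkz_excess_nonneg[of "1 - x" n] assms by (simp add: star_alpha_def)

lemma star_alpha_upper:
  assumes "x \<in> {0..1}" "n \<noteq> 0"
  shows "star_alpha n x \<le> 1 / (2 * real n)"
proof -
  have "star_alpha n x = (mkz_var n x + mkz_var n (1 - x)) / 2"
    unfolding star_alpha_def mkz_excess_def by (simp add: divide_simps) (simp add: algebra_simps)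
  also have "\<dots> \<le> ((1 - x) / real n + (1 - (1 - x)) / real n) / 2"
    by (intro divide_right_mono add_mono mkz_var_upper) (use assms in auto)
  also have "\<dots> = 1 / (2 * real n)" by (simp flip: add_divide_distrib)
  finally show ?thesis .
qed

lemma star_alpha_0: "star_alpha n 0 = 1 / (2 * (real n + 2))"
  and star_alpha_1: "star_alpha n 1 = 1 / (2 * (real n + 2))"
  by (simp_all add: star_alpha_def mkz_excess_0 mkz_excess_1)

lemma star_alpha_lipschitz:
  assumes "x \<in> {0..1}" "y \<in> {0..1}" "n \<noteq> 0"
  shows "\<bar>star_alpha n x - star_alpha n y\<bar> \<le> 2 / (real n * (real n + 2)) * \<bar>x - y\<bar>"
proof -
  have mean: "\<bar>(u + v) / 2\<bar> \<le> k" if "\<bar>u\<bar> \<le> k" "\<bar>v\<bar> \<le> k" for u v k :: real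
    using that by (auto simp: abs_le_iff)
  have "star_alpha n x - star_alpha n y =
      ((mkz_excess n x - mkz_excess n y) + (mkz_excess n (1 - x) - mkz_excess n (1 - y))) / 2"
    by (simp add: star_alpha_def add_divide_distrib diff_divide_distrib)
  also have "\<bar>\<dots>\<bar> \<le> 2 / (real n * (real n + 2)) * \<bar>x - y\<bar>"
    using mkz_excess_lipschitz[OF assms] mkz_excess_lipschitz[of "1 - x" "1 - y" n] assms
    by (intro mean) (simp_all add: abs_minus_commute)
  finally show ?thesis .
qed

lemma star_alpha_C01:
  assumes "n \<noteq> 0"
  shows "star_alpha n \<in> C01"
proof -
  have "(2 / (real n * (real n + 2)))-lipschitz_on {0..1} (star_alpha n)"
    using star_alpha_lipschitz[OF _ _ assms] by (intro lipschitz_onI) (auto simp: dist_real_def)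
  then show ?thesis unfolding C01_def using lipschitz_on_continuous_on by blast
qed

section \<open>The norm, \<open>alpha\<close>, \<open>nu\<close> and membership in
  \<open>Lambda\<close>\<close>

lemma MKZ_star_psi_quotient:
  assumes "x \<in> {0<..<1}"
  shows "MKZ_star (Suc n) psi x / psi x = 1 - star_alpha n x"
  using psi_pos[OF assms] MKZ_star_psi[of x n] assms by simp

lemma norm_psi_MKZ_star:
  assumes "n \<noteq> 0"
  shows "norm_psi (MKZ_star (Suc n) psi) = ereal (1 - 1 / (2 * (real n + 2)))"
proof -
  have eq: "\<bar>MKZ_star (Suc n) psi x\<bar> / psi x = 1 - star_alpha n x" if "x \<in> {0<..<1}" for x
  proof -
    have "1 / (2 * real n) \<le> 1" using assms by (simp add: divide_le_eq)
    moreover have "star_alpha n x \<le> 1 / (2 * real n)" using that by (intro star_alpha_upper assms) simp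
    ultimately have "star_alpha n x \<le> 1" by linarith
    with psi_pos[OF that] show ?thesis using MKZ_star_psi_quotient[OF that, of n] psi_pos[OF that] MKZ_star_psi[of x n] that
      by (simp add: abs_mult)
  qed
  show ?thesis unfolding norm_psi_def
  proof (rule SUP_eqI)
    fix x :: real assume "x \<in> {0<..<1}"
    then show "ereal (\<bar>MKZ_star (Suc n) psi x\<bar> / psi x) \<le> ereal (1 - 1 / (2 * (real n + 2)))"
      using eq[of x] star_alpha_lower[of x n] assms by simp
  next
    fix y assume y: "\<And>x. x \<in> {0<..<1} \<Longrightarrow> ereal (\<bar>MKZ_star (Suc n) psi x\<bar> / psi x) \<le> y"
    \<comment> \<open>The value sought belongs to the excluded point 0, so leastness is obtained by
      passing to the limit from the right.\<close>
    have "continuous_on {0..1} (star_alpha n)" using star_alpha_C01[OF assms] by (simp add: C01_def)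
    then have "(star_alpha n \<longlongrightarrow> star_alpha n 0) (at 0 within {0..1})"
      by (simp add: continuous_on_def)
    then have "(star_alpha n \<longlongrightarrow> star_alpha n 0) (at_right 0)"
      by (simp add: at_within_Icc_at_right)
    then have "((\<lambda>x. ereal (1 - star_alpha n x)) \<longlongrightarrow> ereal (1 - star_alpha n 0)) (at_right 0)"
      by (intro tendsto_intros)
    moreover have "eventually (\<lambda>x. ereal (1 - star_alpha n x) \<le> y) (at_right 0)"
      using eventually_at_right_real[of 0 1] y eq by (auto elim!: eventually_mono)
    ultimately have "ereal (1 - star_alpha n 0) \<le> y"
      by (intro tendsto_upperbound) auto
    then show "ereal (1 - 1 / (2 * (real n + 2))) \<le> y" by (simp add: star_alpha_0)
  qed
qed

text \<open>At the end points \<open>b\<close> is defined through the norm, whose value matches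
  \<open>star_alpha\<close> there; the closed form thus holds on all of
  \<open>{0..1}\<close>.\<close>

lemma alpha_MKZ_star:
  assumes "x \<in> {0..1}" "n \<noteq> 0"
  shows "alpha (MKZ_star (Suc n)) x = star_alpha n x"
proof (cases "x \<in> {0<..<1}")
  case True
  then show ?thesis by (simp add: alpha_def b_def MKZ_star_psi_quotient)
next
  case False
  then have "x = 0 \<or> x = 1" using assms by auto
  then show ?thesis
    by (auto simp: alpha_def b_def norm_psi_MKZ_star assms(2) star_alpha_0 star_alpha_1)
qed

lemma nu_MKZ_star:
  assumes "n \<noteq> 0"
  shows "nu (MKZ_star (Suc n)) = 1 / (2 * (real n + 2))"
  unfolding nu_def
proof (rule Least_equality)
  show "1 / (2 * (real n + 2)) \<in> alpha (MKZ_star (Suc n)) ` {0..1}"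
    using alpha_MKZ_star[of 0 n] assms by (intro image_eqI[of _ _ 0]) (auto simp: star_alpha_0)
  show "1 / (2 * (real n + 2)) \<le> v" if "v \<in> alpha (MKZ_star (Suc n)) ` {0..1}" for v
    using that star_alpha_lower[OF _ assms] alpha_MKZ_star[OF _ assms] by auto
qed

lemma MKZ_star_Lambda:
  assumes "n \<noteq> 0"
  shows "MKZ_star (Suc n) \<in> Lambda"
proof -
  have "positive_linear_operator (MKZ_star (Suc n))"
    unfolding positive_linear_operator_def
    by (auto intro: MKZ_star_C01 MKZ_star_cong MKZ_star_linear MKZ_star_nonneg)
  moreover have "preserves_linear_functions (MKZ_star (Suc n))"
    using MKZ_star_affine by (simp add: preserves_linear_functions_def e_def)
  moreover have "norm_psi (MKZ_star (Suc n) psi) < 1"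
    by (simp add: norm_psi_MKZ_star assms)
  \<comment> \<open>\<open>B1\<close> annihilates \<open>psi\<close>, while here the value is a
    positive multiple of \<open>psi (1/2)\<close>.\<close>
  moreover have "MKZ_star (Suc n) psi (1/2) \<noteq> B1 psi (1/2)"
  proof -
    have "star_alpha n (1/2) \<le> 1 / (2 * real n)" using assms by (intro star_alpha_upper) auto
    also have "\<dots> < 1" using assms by (simp add: divide_less_eq)
    finally show ?thesis using MKZ_star_psi[of "1/2" n] by (simp add: B1_def psi_def)
  qed
  then have "\<exists>f\<in>C01. \<exists>x\<in>{0..1}. MKZ_star (Suc n) f x \<noteq> B1 f x"
    by (intro bexI[of _ psi] bexI[of _ "1/2"]) (auto simp: psi_C01)
  ultimately show ?thesis by (simp add: Lambda_def)
qed

section \<open>Quantitative forms of the three asymptotic claims\<close>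

lemma M_MKZ_star: "M (MKZ_star n) k x = MKZ_star n (\<lambda>t. (t - x) ^ k) x"
  by (simp add: M_def e_def)

text \<open>The factor \<open>psi x\<close> of the fourth moment is traded for the second moment
  through the lower bound on \<open>star_alpha\<close>. This costs a factor
  \<open>2 * (n + 2)\<close> and still leaves order \<open>1 / n\<close>.\<close>

lemma M4_MKZ_star_le:
  assumes "x \<in> {0..1}" "n \<noteq> 0"
  shows "M (MKZ_star (Suc n)) 4 x \<le> 14 * (real n + 2) / (real (Suc n))\<^sup>2 * M (MKZ_star (Suc n)) 2 x"
proof -
  have "M (MKZ_star (Suc n)) 4 x \<le> 7 / (real (Suc n))\<^sup>2 * psi x"
    unfolding M_MKZ_star by (rule MKZ_star_fourth_moment[OF assms(1)])
  also have "\<dots> = 14 * (real n + 2) / (real (Suc n))\<^sup>2 * (1 / (2 * (real n + 2)) * psi x)"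
  proof -
    have cancel: "7 / k * p = 14 * m / k * (1 / (2 * m) * p)" if "m \<noteq> 0" for m k p :: real
      using that by simp
    show ?thesis by (rule cancel) simp
  qed
  also have "\<dots> \<le> 14 * (real n + 2) / (real (Suc n))\<^sup>2 * (star_alpha n x * psi x)"
    using assms by (intro mult_left_mono mult_right_mono star_alpha_lower psi_nonneg) auto
  also have "star_alpha n x * psi x = M (MKZ_star (Suc n)) 2 x"
    unfolding M_MKZ_star by (rule MKZ_star_second_moment[OF assms(1), symmetric])
  finally show ?thesis .
qed

lemma eta_MKZ_star_le:
  assumes "n \<noteq> 0"
  shows "eta (MKZ_star (Suc n)) \<le> ereal (4 / real n)" "0 \<le> eta (MKZ_star (Suc n))"
proof -
  show "eta (MKZ_star (Suc n)) \<le> ereal (4 / real n)"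
    unfolding eta_def
  proof (intro SUP_least, clarify)
    fix x y :: real assume xy: "x \<in> {0..1}" "y \<in> {0..1}"
    have "\<bar>star_alpha n x - star_alpha n y\<bar> \<le> 2 / (real n * (real n + 2)) * \<bar>x - y\<bar>"
      by (rule star_alpha_lipschitz[OF xy assms])
    also have "\<dots> \<le> 2 / (real n * (real n + 2)) * 1"
      using xy by (intro mult_left_mono) auto
    finally have "\<bar>star_alpha n x - star_alpha n y\<bar> * (2 * (real n + 2)) \<le>
        2 / (real n * (real n + 2)) * 1 * (2 * (real n + 2))" by (intro mult_right_mono) auto
    also have "\<dots> = 4 / real n"
    proof -
      have cancel: "2 / (k * m) * 1 * (2 * m) = 4 / k" if "m \<noteq> 0" for m k :: real
        using that by simp
      show ?thesis by (rule cancel) simp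
    qed
    finally show "ereal (\<bar>alpha (MKZ_star (Suc n)) x - alpha (MKZ_star (Suc n)) y\<bar> / nu (MKZ_star (Suc n)))
        \<le> ereal (4 / real n)"
      unfolding alpha_MKZ_star[OF xy(1) assms] alpha_MKZ_star[OF xy(2) assms] nu_MKZ_star[OF assms] by simp
  qed
  show "0 \<le> eta (MKZ_star (Suc n))"
    unfolding eta_def by (rule SUP_upper2[of "(0, 0)"]) auto
qed

text \<open>Expand the square of \<open>\<bar>u\<bar> - 2 * d\<close>. The parameter
  \<open>d\<close> remains free for later balancing.\<close>

lemma abs_le_half_square: "\<bar>u\<bar> \<le> d + u\<^sup>2 / (4 * d)" if "0 < d" for u d :: real
proof -
  have "0 \<le> (\<bar>u\<bar> - 2 * d)\<^sup>2 / (4 * d)" using that by simp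
  also have "\<dots> = d + u\<^sup>2 / (4 * d) - \<bar>u\<bar>"
    using that by (simp add: field_simps power2_eq_square)
  finally show ?thesis by simp
qed

text \<open>The Lipschitz bound and the splitting of \<open>\<bar>t - x\<bar>\<close> reduce the
  deviation to the images of \<open>psi\<close> and of \<open>(t - x)^2\<close>, each a multiple of
  \<open>psi x\<close>.\<close>

lemma MKZ_star_alpha_deviation:
  assumes "x \<in> {0..1}" "n \<noteq> 0" "0 < d"
  shows "MKZ_star (Suc n) (\<lambda>t. psi t * \<bar>alpha (MKZ_star (Suc n)) t - alpha (MKZ_star (Suc n)) x * e 0 t\<bar>) x
    \<le> 8 * (real n + 2) / real n * (d + 1 / (8 * real n * d)) * ((nu (MKZ_star (Suc n)))\<^sup>2 * psi x)"
    (is "?L \<le> _")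
proof -
  let ?K = "2 / (real n * (real n + 2))"
  have "?L = MKZ_star (Suc n) (\<lambda>t. psi t * \<bar>star_alpha n t - star_alpha n x\<bar>) x"
    by (rule MKZ_star_cong) (simp add: alpha_MKZ_star alpha_MKZ_star[OF assms(1,2)] assms(2) e_def)
  also have "\<dots> \<le> MKZ_star (Suc n) (\<lambda>t. (?K * d) * psi t + (?K / (4 * d)) * (t - x)\<^sup>2) x"
  proof (rule MKZ_star_mono[OF _ _ _ assms(1)])
    show "(\<lambda>t. psi t * \<bar>star_alpha n t - star_alpha n x\<bar>) \<in> C01"
      "(\<lambda>t. (?K * d) * psi t + (?K / (4 * d)) * (t - x)\<^sup>2) \<in> C01"
      using star_alpha_C01[OF assms(2)] psi_C01 assms(2,3) by (auto simp: C01_def intro!: continuous_intros)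
    fix t :: real assume t: "t \<in> {0..1}"
    have psi1: "psi t \<le> 1" using t mult_mono[of t 1 "1 - t" 1] by (simp add: psi_def)
    have "psi t * \<bar>star_alpha n t - star_alpha n x\<bar> \<le> psi t * (?K * \<bar>t - x\<bar>)"
      by (intro mult_left_mono star_alpha_lipschitz psi_nonneg t assms)
    also have "\<dots> \<le> psi t * (?K * (d + (t - x)\<^sup>2 / (4 * d)))"
      by (intro mult_left_mono abs_le_half_square psi_nonneg t assms) simp
    also have "\<dots> = (?K * d) * psi t + psi t * ((?K / (4 * d)) * (t - x)\<^sup>2)"
    proof -
      have expand: "p * (K * (d + s / (4 * d))) = (K * d) * p + p * ((K / (4 * d)) * s)" for p K s
        by (simp add: distrib_left mult_ac)
      show ?thesis by (rule expand)
    qed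
    \<comment> \<open>\<open>psi t\<close> is kept in the first term, where the operator returns at
      most \<open>psi x\<close>, and replaced by 1 in the second, where the second moment provides
      \<open>psi x\<close>.\<close>
    also have "\<dots> \<le> (?K * d) * psi t + 1 * ((?K / (4 * d)) * (t - x)\<^sup>2)"
      using psi1 assms by (intro add_left_mono mult_right_mono) auto
    finally show "psi t * \<bar>star_alpha n t - star_alpha n x\<bar> \<le> (?K * d) * psi t + (?K / (4 * d)) * (t - x)\<^sup>2"
      by simp
  qed
  also have "\<dots> = (?K * d) * MKZ_star (Suc n) psi x + (?K / (4 * d)) * MKZ_star (Suc n) (\<lambda>t. (t - x)\<^sup>2) x"
    using psi_C01 assms by (intro MKZ_star_linear) (auto simp: C01_def intro!: continuous_intros)
  also have "\<dots> = (?K * d) * ((1 - star_alpha n x) * psi x) + (?K / (4 * d)) * (star_alpha n x * psi x)"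
    by (simp only: MKZ_star_psi[OF assms(1)] MKZ_star_second_moment[OF assms(1)])
  also have "\<dots> \<le> (?K * d) * (1 * psi x) + (?K / (4 * d)) * (1 / (2 * real n) * psi x)"
  proof -
    have "0 \<le> star_alpha n x" using star_alpha_lower[OF assms(1,2)]
      by (rule order_trans[rotated]) simp
    then show ?thesis
      using assms(3) by (intro add_mono mult_left_mono mult_right_mono psi_nonneg star_alpha_upper assms) auto
  qed
  also have "\<dots> = ?K * (d + 1 / (8 * real n * d)) * psi x"
  proof -
    have expand: "(K * d) * (1 * p) + (K / (4 * d)) * (1 / (2 * m) * p) = K * (d + 1 / (8 * m * d)) * p"
      for K m p :: real
      by (simp add: distrib_left distrib_right mult_ac)
    show ?thesis by (rule expand)
  qed
  \<comment> \<open>The Lipschitz constant is already of order \<open>nu\<close> squared; this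
    extracts that factor.\<close>
  also have "?K = 8 * (real n + 2) / real n * (1 / (2 * (real n + 2)))\<^sup>2"
    using assms(2) by (simp add: divide_simps power2_eq_square) (simp add: algebra_simps)
  finally show ?thesis by (simp only: nu_MKZ_star[OF assms(2)] mult_ac)
qed

text \<open>Converts estimates for index \<open>Suc n\<close> to index \<open>n\<close>; the
  bounding sequence is moved by one accordingly.\<close>

lemma uniform_little_oI:
  assumes "\<And>n. n \<noteq> 0 \<Longrightarrow> 0 < c n" "c \<longlonglongrightarrow> 0"
    and "\<And>n x. n \<noteq> 0 \<Longrightarrow> x \<in> {0..1} \<Longrightarrow> A (Suc n) x \<le> c n * B (Suc n) x"
  shows "uniform_little_o A B"
  unfolding uniform_little_o_def
proof (intro exI[of _ "\<lambda>n. c (n - 1)"] conjI allI impI ballI)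
  show "(\<lambda>n. c (n - 1)) \<longlonglongrightarrow> 0"
    using assms(2) by (subst filterlim_sequentially_Suc[symmetric]) simp
  fix n :: nat assume n: "3 \<le> n"
  then show "0 < c (n - 1)" by (intro assms(1)) simp
  fix x :: real assume "x \<in> {0..1}"
  then show "A n x \<le> c (n - 1) * B n x" using assms(3)[of "n - 1" x] n by simp
qed

theorem mainTheorem4:
  shows "(\<forall>n\<ge>3. MKZ_star n \<in> Lambda) \<and>
    uniform_little_o (\<lambda>n. M (MKZ_star n) 4) (\<lambda>n. M (MKZ_star n) 2) \<and>
    (\<lambda>n. eta (MKZ_star n)) \<longlonglongrightarrow> 0 \<and>
    uniform_little_o
      (\<lambda>n x. MKZ_star n (\<lambda>t. psi t * \<bar>alpha (MKZ_star n) t - alpha (MKZ_star n) x * e 0 t\<bar>) x)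
      (\<lambda>n x. (nu (MKZ_star n))\<^sup>2 * psi x)"
proof (intro conjI)
  show "\<forall>n\<ge>3. MKZ_star n \<in> Lambda"
  proof (intro allI impI)
    fix n :: nat assume "3 \<le> n"
    then show "MKZ_star n \<in> Lambda" using MKZ_star_Lambda[of "n - 1"] by simp
  qed
  show "uniform_little_o (\<lambda>n. M (MKZ_star n) 4) (\<lambda>n. M (MKZ_star n) 2)"
  proof (rule uniform_little_oI[where c = "\<lambda>n. 14 * (real n + 2) / (real (Suc n))\<^sup>2", OF _ _ M4_MKZ_star_le])
    show "(\<lambda>n. 14 * (real n + 2) / (real (Suc n))\<^sup>2) \<longlonglongrightarrow> 0" by real_asymp
  qed (auto intro!: divide_pos_pos)
  have "(\<lambda>n. eta (MKZ_star (Suc n))) \<longlonglongrightarrow> 0"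
  proof (rule tendsto_sandwich)
    show "\<forall>\<^sub>F n in sequentially. (0 :: ereal) \<le> eta (MKZ_star (Suc n))"
      using eventually_gt_at_top[of 0] by eventually_elim (simp add: eta_MKZ_star_le)
    show "\<forall>\<^sub>F n in sequentially. eta (MKZ_star (Suc n)) \<le> ereal (4 / real n)"
      using eventually_gt_at_top[of 0] by eventually_elim (rule eta_MKZ_star_le, simp)
    have "(\<lambda>n. 4 / real n) \<longlonglongrightarrow> 0" by real_asymp
    then show "(\<lambda>n. ereal (4 / real n)) \<longlonglongrightarrow> 0" unfolding zero_ereal_def by (rule tendsto_ereal)
  qed simp
  then show "(\<lambda>n. eta (MKZ_star n)) \<longlonglongrightarrow> 0"
    by (subst (asm) filterlim_sequentially_Suc)
  show "uniform_little_o
      (\<lambda>n x. MKZ_star n (\<lambda>t. psi t * \<bar>alpha (MKZ_star n) t - alpha (MKZ_star n) x * e 0 t\<bar>) x)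
      (\<lambda>n x. (nu (MKZ_star n))\<^sup>2 * psi x)"
  \<comment> \<open>The free parameter is \<open>d = 1 / sqrt n\<close>, which makes both
    \<open>d\<close> and \<open>1 / (8 * n * d)\<close> of order \<open>1 / sqrt n\<close>.\<close>
  proof (rule uniform_little_oI[where c = "\<lambda>n. 8 * (real n + 2) / real n * (1 / sqrt (real n) + 1 / (8 * real n * (1 / sqrt (real n))))",
        OF _ _ MKZ_star_alpha_deviation])
    show "(\<lambda>n. 8 * (real n + 2) / real n * (1 / sqrt (real n) + 1 / (8 * real n * (1 / sqrt (real n))))) \<longlonglongrightarrow> 0"
      by real_asymp
  qed (auto intro!: mult_pos_pos add_pos_pos divide_pos_pos)
qed

end
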